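(* Let $n\ge 1$, let $A,B,C,D\in\mathbb{M}_n$ be positive definite matrices, and let $\alpha,\beta>0$ be real numbers. Then for every $r\in(-1,0)\cup(1,2)$, $$(\alpha A+\beta B)^r\circ(\alpha C+\beta D)^{1-r}\le \alpha\,(A^r\circ C^{1-r})+\beta\,(B^r\circ D^{1-r}).$$
   Context: $\mathbb{M}_n$ is the space of $n\times n$ complex matrices. A Hermitian matrix $X$ is positive semidefinite ($X\ge 0$) if $x^*Xx\ge 0$ for all $x\in\mathbb{C}^n$, and positive definite ($X>0$) if moreover it is invertible. For Hermitian $X,Y$, $X\le Y$ means $Y-X\ge 0$. $A\circ B$ denotes the Hadamard (entrywise) product. Real powers of positive definite matrices are taken via the spectral functional calculus. *)

theory Defs
  imports "HOL-Analysis.Analysis" "HOL-Library.Complex_Order"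
begin

definition cadjoint :: "complex^'n^'n \<Rightarrow> complex^'n^'n" where
  "cadjoint A = (\<chi> i j. cnj (A $ j $ i))"

definition hermitian :: "complex^'n^'n \<Rightarrow> bool" where
  "hermitian A \<longleftrightarrow> cadjoint A = A"

definition unitary :: "complex^'n^'n \<Rightarrow> bool" where
  "unitary U \<longleftrightarrow> cadjoint U ** U = mat 1 \<and> U ** cadjoint U = mat 1"

text \<open>The product \<open>x\<^sup>* y\<close>, conjugate-linear in the first argument.\<close>

definition cdot :: "complex^'n \<Rightarrow> complex^'n \<Rightarrow> complex" where
  "cdot x y = (\<Sum>i\<in>UNIV. cnj (x $ i) * y $ i)"

text \<open>In the next definition \<open>0 \<le> z\<close> is the order of \<^theory>\<open>HOL-Library.Complex_Order\<close>:
  \<open>z\<close> is real and nonnegative.\<close>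

definition psd :: "complex^'n^'n \<Rightarrow> bool" where
  "psd X \<longleftrightarrow> hermitian X \<and> (\<forall>x. 0 \<le> cdot x (X *v x))"

definition pos_def :: "complex^'n^'n \<Rightarrow> bool" where
  "pos_def X \<longleftrightarrow> psd X \<and> invertible X"

definition loewner_le :: "complex^'n^'n \<Rightarrow> complex^'n^'n \<Rightarrow> bool" (infix \<open>\<le>\<^sub>L\<close> 50) where
  "X \<le>\<^sub>L Y \<longleftrightarrow> hermitian X \<and> hermitian Y \<and> psd (Y - X)"

definition hadamard :: "complex^'n^'n \<Rightarrow> complex^'n^'n \<Rightarrow> complex^'n^'n" (infixl \<open>\<odot>\<close> 70) where
  "A \<odot> B = (\<chi> i j. A $ i $ j * B $ i $ j)"

definition rdiag :: "('n \<Rightarrow> real) \<Rightarrow> complex^'n^'n" where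
  "rdiag d = (\<chi> i j. if i = j then complex_of_real (d i) else 0)"

definition spectral_decomp :: "complex^'n^'n \<Rightarrow> complex^'n^'n \<Rightarrow> ('n \<Rightarrow> real) \<Rightarrow> bool" where
  "spectral_decomp A U d \<longleftrightarrow> unitary U \<and> A = U ** rdiag d ** cadjoint U"

text \<open>Functional calculus: \<open>f(U diag(d) U\<^sup>*) = U diag(f \<circ> d) U\<^sup>*\<close>. For Hermitian \<open>A\<close> a spectral
  decomposition exists and the result does not depend on it; see
  \<open>hermitian_spectral_decomp\<close> and \<open>fun_calc_eq\<close> below.\<close>

definition fun_calc :: "(real \<Rightarrow> real) \<Rightarrow> complex^'n^'n \<Rightarrow> complex^'n^'n" where
  "fun_calc f A =
     (THE X. \<exists>U d. spectral_decomp A U d \<and> X = U ** rdiag (\<lambda>i. f (d i)) ** cadjoint U)"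

definition mpow :: "complex^'n^'n \<Rightarrow> real \<Rightarrow> complex^'n^'n" (infixr \<open>mpow\<close> 80) where
  "A mpow r = fun_calc (\<lambda>t. t powr r) A"


subsection \<open>The functional calculus is well defined\<close>

lemma rdiag_mult_right: "(M ** rdiag d) $ i $ j = M $ i $ j * complex_of_real (d j)"
  by (simp add: matrix_matrix_mult_def rdiag_def if_distrib cong: if_cong)

lemma rdiag_mult_left: "(rdiag d ** M) $ i $ j = complex_of_real (d i) * M $ i $ j"
  by (simp add: matrix_matrix_mult_def rdiag_def if_distrib if_distribR cong: if_cong)

lemma spectral_unique:
  assumes A: "spectral_decomp A U d" and B: "spectral_decomp A V e"
  shows "U ** rdiag (\<lambda>i. f (d i)) ** cadjoint U = V ** rdiag (\<lambda>i. f (e i)) ** cadjoint V"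
proof -
  have U: "cadjoint U ** U = mat 1" "U ** cadjoint U = mat 1"
    and V: "cadjoint V ** V = mat 1" "V ** cadjoint V = mat 1"
    using A B by (auto simp: spectral_decomp_def unitary_def)
  define W where "W = cadjoint V ** U"
  have AU: "U ** rdiag d ** cadjoint U = V ** rdiag e ** cadjoint V"
    using A B by (simp add: spectral_decomp_def)
  have "cadjoint V ** (U ** rdiag d ** cadjoint U) ** U
      = cadjoint V ** (V ** rdiag e ** cadjoint V) ** U"
    by (simp add: AU)
  moreover have "cadjoint V ** (U ** rdiag d ** cadjoint U) ** U = W ** rdiag d"
    by (metis W_def U(1) matrix_mul_assoc matrix_mul_rid)
  moreover have "cadjoint V ** (V ** rdiag e ** cadjoint V) ** U = rdiag e ** W"
    by (metis W_def V(1) matrix_mul_assoc matrix_mul_lid)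
  ultimately have W: "W ** rdiag d = rdiag e ** W" by simp
  have "W $ i $ j * complex_of_real (d j) = complex_of_real (e i) * W $ i $ j" for i j
    by (metis W rdiag_mult_left rdiag_mult_right)
  then have "W $ i $ j = 0 \<or> d j = e i" for i j
    by (metis mult.commute mult_cancel_right of_real_eq_iff)
  then have "W $ i $ j * complex_of_real (f (d j)) = complex_of_real (f (e i)) * W $ i $ j" for i j
    by (metis mult.commute mult_zero_left)
  then have Wf: "W ** rdiag (\<lambda>i. f (d i)) = rdiag (\<lambda>i. f (e i)) ** W"
    by (simp add: vec_eq_iff rdiag_mult_left rdiag_mult_right)
  have "U ** rdiag (\<lambda>i. f (d i)) ** cadjoint U
      = V ** (W ** rdiag (\<lambda>i. f (d i))) ** cadjoint U"
    by (metis W_def V(2) matrix_mul_assoc matrix_mul_lid)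
  also have "\<dots> = V ** rdiag (\<lambda>i. f (e i)) ** cadjoint V"
    by (metis Wf W_def U(2) matrix_mul_assoc matrix_mul_rid)
  finally show ?thesis .
qed

lemma fun_calc_eq:
  assumes "spectral_decomp A U d"
  shows "fun_calc f A = U ** rdiag (\<lambda>i. f (d i)) ** cadjoint U"
  unfolding fun_calc_def
  using assms spectral_unique by (intro the_equality) blast+

lemma inner_eq_Re_cdot: "x \<bullet> y = Re (cdot x y)"
  by (simp add: inner_vec_def cdot_def inner_complex_def)

lemma cdot_cnj: "cnj (cdot x y) = cdot y x"
  by (simp add: cdot_def mult.commute)

lemma cdot_add: "cdot x (y + z) = cdot x y + cdot x z"
  by (simp add: cdot_def distrib_left sum.distrib)

lemma cdot_diff: "cdot x (y - z) = cdot x y - cdot x z"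
  by (simp add: cdot_def right_diff_distrib sum_subtractf)

lemma cdot_smult: "cdot x (c *s y) = c * cdot x y"
  by (simp add: cdot_def sum_distrib_left algebra_simps)

lemma cdot_scaleR: "cdot x (c *\<^sub>R y) = complex_of_real c * cdot x y"
  unfolding cdot_def sum_distrib_left vector_scaleR_component
  by (simp add: scaleR_conv_of_real mult.left_commute)

lemma cdot_sum: "cdot x (sum g S) = (\<Sum>s\<in>S. cdot x (g s))"
  unfolding cdot_def by (subst sum.swap) (simp add: sum_distrib_left)

lemma cdot_self: "cdot x x = complex_of_real (x \<bullet> x)"
  using cdot_cnj[of x x] by (simp add: inner_eq_Re_cdot complex_eq_iff)

lemma mult_vec_scaleR:
  fixes A :: "complex^'n^'m"
  shows "A *v (c *\<^sub>R x) = c *\<^sub>R (A *v x)"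
  unfolding vec_eq_iff matrix_vector_mult_def
  by (simp add: scaleR_sum_right)

lemma hermitian_cdot:
  assumes "hermitian A"
  shows "cdot x (A *v y) = cdot (A *v x) y"
proof -
  have A: "cnj (A $ i $ j) = A $ j $ i" for i j
    using assms by (simp add: hermitian_def cadjoint_def vec_eq_iff)
  have "cdot x (A *v y) = (\<Sum>i\<in>UNIV. \<Sum>j\<in>UNIV. cnj (x $ i) * A $ i $ j * y $ j)"
    by (simp add: cdot_def matrix_vector_mult_def sum_distrib_left mult.assoc)
  also have "\<dots> = (\<Sum>j\<in>UNIV. \<Sum>i\<in>UNIV. cnj (x $ i) * A $ i $ j * y $ j)"
    by (rule sum.swap)
  also have "\<dots> = cdot (A *v x) y"
    by (simp add: cdot_def matrix_vector_mult_def sum_distrib_left sum_distrib_right A mult_ac)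
  finally show ?thesis .
qed

lemma extend_eigenbasis:
  fixes A :: "complex^'n^'n" and S :: "(complex^'n) set"
  assumes A: "hermitian A" and S: "finite S" "card S < CARD('n)"
    and orth: "\<And>s t. s \<in> S \<Longrightarrow> t \<in> S \<Longrightarrow> cdot s t = (if s = t then 1 else 0)"
    and ev: "\<And>s. s \<in> S \<Longrightarrow> \<exists>l. A *v s = complex_of_real l *s s"
  shows "\<exists>u l. (\<forall>s\<in>S. cdot s u = 0) \<and> cdot u u = 1 \<and> A *v u = complex_of_real l *s u"
proof -
  define W where "W = {x. \<forall>s\<in>S. cdot s x = 0}"
  have W_add: "x + y \<in> W" if "x \<in> W" "y \<in> W" for x y
    using that by (simp add: W_def cdot_add)
  have W_diff: "x - y \<in> W" if "x \<in> W" "y \<in> W" for x y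
    using that by (simp add: W_def cdot_diff)
  have W_scaleR: "c *\<^sub>R x \<in> W" if "x \<in> W" for c x
    using that by (simp add: W_def cdot_scaleR)
  have W_A: "A *v x \<in> W" if "x \<in> W" for x
  proof -
    have "cdot s (A *v x) = 0" if s: "s \<in> S" for s
    proof -
      obtain l where l: "A *v s = complex_of_real l *s s" using ev[OF s] by blast
      have "cdot s (A *v x) = cdot (A *v s) x" by (rule hermitian_cdot[OF A])
      also have "\<dots> = cnj (cdot x (complex_of_real l *s s))" by (simp add: l cdot_cnj)
      also have "\<dots> = complex_of_real l * cdot s x" by (simp add: cdot_smult cdot_cnj)
      also have "cdot s x = 0" using \<open>x \<in> W\<close> s by (simp add: W_def)
      finally show ?thesis by simp
    qed
    then show ?thesis by (simp add: W_def)
  qed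
  have "vec.span S \<noteq> UNIV"
  proof
    assume "vec.span S = UNIV"
    then have "vec.dim (UNIV :: (complex^'n) set) \<le> card S"
      by (metis vec.dim_le_card S(1) subset_UNIV)
    then show False using S(2) by (simp add: card_cart_basis)
  qed
  then obtain y where y: "y \<notin> vec.span S" by blast
  define x0 where "x0 = y - (\<Sum>s\<in>S. cdot s y *s s)"
  have "(\<Sum>s\<in>S. cdot s y *s s) \<in> vec.span S"
    by (intro vec.span_sum vec.span_scale vec.span_base)
  then have x0: "x0 \<noteq> 0" using y by (auto simp: x0_def)
  have "cdot t x0 = 0" if "t \<in> S" for t
  proof -
    have "cdot t (\<Sum>s\<in>S. cdot s y *s s) = (\<Sum>s\<in>S. if t = s then cdot s y else 0)"
      unfolding cdot_sum cdot_smult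
      by (rule sum.cong) (use orth that in auto)
    also have "\<dots> = cdot t y" using S(1) that by simp
    finally show ?thesis by (simp add: x0_def cdot_diff)
  qed
  then have x0W: "x0 \<in> W" by (simp add: W_def)
  define q where "q x = x \<bullet> (A *v x)" for x
  have cont: "continuous_on T q" for T
    unfolding q_def matrix_vector_mult_def by (intro continuous_intros)
  have "closed W"
  proof -
    have "closed {x. cdot s x = 0}" for s :: "complex^'n"
      unfolding cdot_def by (intro closed_Collect_eq continuous_intros)
    then have "closed (\<Inter>s\<in>S. {x. cdot s x = 0})" by blast
    moreover have "W = (\<Inter>s\<in>S. {x. cdot s x = 0})" by (auto simp: W_def)
    ultimately show ?thesis by simp
  qed
  then have "compact (sphere 0 1 \<inter> W)" by (intro compact_Int_closed compact_sphere)
  moreover have "(1 / norm x0) *\<^sub>R x0 \<in> sphere 0 1 \<inter> W"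
    using x0 x0W by (simp add: W_scaleR)
  ultimately obtain u where u: "u \<in> sphere 0 1 \<inter> W"
    and max: "\<And>x. x \<in> sphere 0 1 \<inter> W \<Longrightarrow> q x \<le> q u"
    using continuous_attains_sup[OF _ _ cont] by (metis empty_iff)
  define l where "l = q u"
  have uu: "u \<bullet> u = 1" and uW: "u \<in> W" using u by (simp_all add: dot_square_norm)
  have q_scaleR: "q (c *\<^sub>R x) = c\<^sup>2 * q x" for c x
    by (simp add: q_def mult_vec_scaleR power2_eq_square)
  have bound: "q x \<le> l * (x \<bullet> x)" if "x \<in> W" for x
  proof (cases "x = 0")
    case True then show ?thesis by (simp add: q_def)
  next
    case False
    have "q ((1 / norm x) *\<^sub>R x) \<le> l"
      unfolding l_def by (rule max) (use False that in \<open>simp add: W_scaleR\<close>)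
    then have "q x / (norm x)\<^sup>2 \<le> l" by (simp add: q_scaleR power_divide)
    then show ?thesis using False by (simp add: pos_divide_le_eq dot_square_norm)
  qed
  define v where "v = A *v u - l *\<^sub>R u"
  have vW: "v \<in> W" unfolding v_def by (intro W_diff W_A W_scaleR uW)
  have "t * (2 * (v \<bullet> v) + t * (q v - l * (v \<bullet> v))) \<le> 0" for t
  proof -
    have sym: "u \<bullet> (A *v v) = v \<bullet> (A *v u)"
      using hermitian_cdot[OF A, of u v] by (metis inner_eq_Re_cdot inner_commute)
    have "q (u + t *\<^sub>R v) \<le> l * ((u + t *\<^sub>R v) \<bullet> (u + t *\<^sub>R v))"
      by (intro bound W_add W_scaleR uW vW)
    moreover have "q (u + t *\<^sub>R v) = l + 2 * t * (v \<bullet> (A *v u)) + t\<^sup>2 * q v"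
      by (simp add: q_def l_def matrix_vector_right_distrib mult_vec_scaleR
            inner_add_left inner_add_right sym power2_eq_square algebra_simps)
    moreover have "(u + t *\<^sub>R v) \<bullet> (u + t *\<^sub>R v) = 1 + 2 * t * (v \<bullet> u) + t\<^sup>2 * (v \<bullet> v)"
      by (simp add: inner_add_left inner_add_right uu inner_commute power2_eq_square algebra_simps)
    moreover have "v \<bullet> v = v \<bullet> (A *v u) - l * (v \<bullet> u)"
      by (subst (2) v_def) (simp add: inner_diff_right)
    ultimately have "l + 2 * t * (v \<bullet> (A *v u)) + t\<^sup>2 * q v
        \<le> l * (1 + 2 * t * (v \<bullet> u) + t\<^sup>2 * (v \<bullet> v))"
      and "2 * t * (v \<bullet> v) = 2 * t * (v \<bullet> (A *v u)) - 2 * t * l * (v \<bullet> u)"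
      by (simp_all add: right_diff_distrib)
    then show ?thesis by (simp add: power2_eq_square algebra_simps)
  qed
  note key = this
  have "v \<bullet> v = 0"
  proof (rule ccontr)
    assume "v \<bullet> v \<noteq> 0"
    then have pos: "v \<bullet> v > 0" by (simp add: order_less_le)
    define c where "c = q v - l * (v \<bullet> v)"
    define t where "t = (v \<bullet> v) / (1 + \<bar>c\<bar>)"
    have t: "t > 0" using pos by (simp add: t_def add_pos_nonneg)
    have "\<bar>t * c\<bar> \<le> v \<bullet> v"
      using pos by (simp add: t_def abs_mult divide_simps add_pos_nonneg mult_left_mono)
    then have "2 * (v \<bullet> v) + t * c > 0" using pos by linarith
    then show False using key[of t] t by (simp add: c_def mult_le_0_iff)
  qed
  then have "A *v u = l *\<^sub>R u" by (simp add: v_def)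
  then have "A *v u = complex_of_real l *s u"
    by (simp add: vec_eq_iff) (simp add: scaleR_conv_of_real)
  moreover have "cdot u u = 1" by (simp add: cdot_self uu)
  ultimately show ?thesis using uW by (auto simp: W_def)
qed

lemma exists_eigenbasis:
  fixes A :: "complex^'n^'n"
  assumes A: "hermitian A" and "k \<le> CARD('n)"
  shows "\<exists>S. finite S \<and> card S = k
      \<and> (\<forall>s\<in>S. \<forall>t\<in>S. cdot s t = (if s = t then 1 else 0))
      \<and> (\<forall>s\<in>S. \<exists>l. A *v s = complex_of_real l *s s)"
  using \<open>k \<le> CARD('n)\<close>
proof (induction k)
  case 0
  show ?case by (intro exI[of _ "{}"]) simp
next
  case (Suc k)
  then obtain S where S: "finite S" "card S = k"
    and orth: "\<forall>s\<in>S. \<forall>t\<in>S. cdot s t = (if s = t then 1 else 0)"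
    and ev: "\<forall>s\<in>S. \<exists>l. A *v s = complex_of_real l *s s"
    by auto
  obtain u l where u: "\<forall>s\<in>S. cdot s u = 0" "cdot u u = 1" "A *v u = complex_of_real l *s u"
    using extend_eigenbasis[OF A S(1)] S(2) Suc.prems orth ev by (metis Suc_le_lessD)
  have "\<forall>s\<in>S. cdot u s = 0" using u(1) by (metis cdot_cnj complex_cnj_zero)
  moreover have "u \<notin> S" using u by force
  ultimately show ?case
    using S orth ev u by (intro exI[of _ "insert u S"]) auto
qed

lemma hermitian_spectral_decomp:
  fixes A :: "complex^'n^'n"
  assumes "hermitian A"
  shows "\<exists>U d. spectral_decomp A U d"
proof -
  obtain S where S: "finite S" "card S = CARD('n)"
    and orth: "\<forall>s\<in>S. \<forall>t\<in>S. cdot s t = (if s = t then 1 else 0)"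
    and ev: "\<forall>s\<in>S. \<exists>l. A *v s = complex_of_real l *s s"
    using exists_eigenbasis[OF assms order_refl] by blast
  obtain b where b: "bij_betw b (UNIV :: 'n set) S"
    using finite_same_card_bij[OF finite S(1), of "UNIV :: 'n set"] S(2) by auto
  have bS: "b j \<in> S" for j using b by (auto simp: bij_betw_def)
  have binj: "b i = b j \<longleftrightarrow> i = j" for i j
    using b by (auto simp: bij_betw_def inj_on_def)
  obtain d where d: "\<forall>j. A *v b j = complex_of_real (d j) *s b j"
  proof -
    have "\<forall>j. \<exists>l. A *v b j = complex_of_real l *s b j" using ev bS by blast
    from choice[OF this] show thesis using that by blast
  qed
  define U :: "complex^'n^'n" where "U = (\<chi> i j. b j $ i)"
  have "(cadjoint U ** U) $ i $ j = cdot (b i) (b j)" for i j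
    by (simp add: cadjoint_def U_def matrix_matrix_mult_def cdot_def)
  then have "(cadjoint U ** U) $ i $ j = (if i = j then 1 else 0)" for i j
    by (simp add: orth bS binj)
  then have 1: "cadjoint U ** U = mat 1"
    by (simp add: vec_eq_iff mat_def)
  then have 2: "U ** cadjoint U = mat 1" by (simp add: matrix_left_right_inverse)
  have "(A ** U) $ i $ j = (A *v b j) $ i" for i j
    by (simp add: U_def matrix_matrix_mult_def matrix_vector_mult_def)
  then have "A ** U = U ** rdiag d"
    by (simp add: vec_eq_iff rdiag_mult_right d) (simp add: U_def)
  then have "A = U ** rdiag d ** cadjoint U"
    by (metis 2 matrix_mul_assoc matrix_mul_rid)
  then show ?thesis using 1 2 by (auto simp: spectral_decomp_def unitary_def)
qed

lemma spectral_decomp_eigenvector: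
  assumes "spectral_decomp A U d"
  shows "A *v column j U = complex_of_real (d j) *s column j U"
proof -
  have "A ** U = U ** rdiag d"
    using assms unfolding spectral_decomp_def unitary_def
    by (metis matrix_mul_assoc matrix_mul_rid)
  then have "(A ** U) $ i $ j = U $ i $ j * complex_of_real (d j)" for i
    by (simp add: rdiag_mult_right)
  then show ?thesis
    by (simp add: vec_eq_iff column_def matrix_matrix_mult_def matrix_vector_mult_def mult.commute)
qed

lemma pos_def_eigenvalues_pos:
  assumes A: "pos_def A" and D: "spectral_decomp A U d"
  shows "d j > 0"
proof -
  let ?u = "column j U"
  have "(cadjoint U ** U) $ j $ j = cdot ?u ?u"
    by (simp add: cadjoint_def column_def matrix_matrix_mult_def cdot_def)
  then have uu: "cdot ?u ?u = 1"
    using D by (simp add: spectral_decomp_def unitary_def mat_def)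
  have "0 \<le> cdot ?u (A *v ?u)" using A by (simp add: pos_def_def psd_def)
  then have "0 \<le> d j"
    by (simp add: spectral_decomp_eigenvector[OF D] cdot_smult uu less_eq_complex_def)
  moreover have "d j \<noteq> 0"
  proof
    assume "d j = 0"
    then have "A *v ?u = 0" by (simp add: spectral_decomp_eigenvector[OF D])
    moreover obtain B where "B ** A = mat 1"
      using A by (auto simp: pos_def_def invertible_def)
    ultimately have "?u = 0"
      by (metis matrix_vector_mul_assoc matrix_vector_mul_lid matrix_vector_mult_0_right)
    then show False using uu by (simp add: cdot_def)
  qed
  ultimately show ?thesis by simp
qed

end

(*
  Exchanging the two factors replaces r by 1 - r, so let 1 < r < 2. Writing L and R for the commuting
  operators Y |-> A Y and Y |-> Y C^T on matrices, x^*(A^r o C^(1-r)) x is the quadratic form of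
  L^r R^(1-r) at diag(x). The scalar identity
    K p^r q^(1-r) = integral over t > 0 of t^(r-2) p^2 / (p + t q)
  expresses it through L (L + t R)^(-1) L, whose quadratic form at X equals
    sup_Y 2 Re <Y, L X> - <Y, (L + t R) Y>.
  A supremum of functions linear in (A, C) is convex, and integration preserves convexity.
*)

theory Submission
  imports Defs
begin

subsection \<open>Matrices and the Frobenius pairing\<close>

definition fdot :: "complex^'n^'m \<Rightarrow> complex^'n^'m \<Rightarrow> complex" where
  "fdot Y X = (\<Sum>i\<in>UNIV. \<Sum>j\<in>UNIV. cnj (Y $ i $ j) * X $ i $ j)"

lemma fdot_add_right: "fdot Y (X + Z) = fdot Y X + fdot Y Z"
  by (simp add: fdot_def distrib_left sum.distrib)

lemma fdot_scaleR_right: "fdot Y (c *\<^sub>R X) = of_real c * fdot Y X"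
  unfolding fdot_def sum_distrib_left vector_scaleR_component
  by (simp add: scaleR_conv_of_real mult_ac)

lemma fdot_mult_left: "fdot Y (M ** X) = fdot (cadjoint M ** Y) X"
proof -
  have "fdot Y (M ** X)
      = (\<Sum>i\<in>UNIV. \<Sum>j\<in>UNIV. \<Sum>k\<in>UNIV. cnj (Y $ i $ j) * M $ i $ k * X $ k $ j)"
    by (simp add: fdot_def matrix_matrix_mult_def sum_distrib_left mult.assoc)
  also have "\<dots> = (\<Sum>i\<in>UNIV. \<Sum>k\<in>UNIV. \<Sum>j\<in>UNIV. cnj (Y $ i $ j) * M $ i $ k * X $ k $ j)"
    by (rule sum.cong[OF refl], rule sum.swap)
  also have "\<dots> = (\<Sum>k\<in>UNIV. \<Sum>i\<in>UNIV. \<Sum>j\<in>UNIV. cnj (Y $ i $ j) * M $ i $ k * X $ k $ j)"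
    by (rule sum.swap)
  also have "\<dots> = (\<Sum>k\<in>UNIV. \<Sum>j\<in>UNIV. \<Sum>i\<in>UNIV. cnj (Y $ i $ j) * M $ i $ k * X $ k $ j)"
    by (rule sum.cong[OF refl], rule sum.swap)
  also have "\<dots> = fdot (cadjoint M ** Y) X"
    by (simp add: fdot_def matrix_matrix_mult_def cadjoint_def sum_distrib_left sum_distrib_right mult_ac)
  finally show ?thesis .
qed

lemma fdot_mult_right: "fdot Y (X ** N) = fdot (Y ** cadjoint N) X"
proof -
  have "fdot Y (X ** N)
      = (\<Sum>i\<in>UNIV. \<Sum>j\<in>UNIV. \<Sum>k\<in>UNIV. cnj (Y $ i $ j) * X $ i $ k * N $ k $ j)"
    by (simp add: fdot_def matrix_matrix_mult_def sum_distrib_left mult.assoc)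
  also have "\<dots> = (\<Sum>i\<in>UNIV. \<Sum>k\<in>UNIV. \<Sum>j\<in>UNIV. cnj (Y $ i $ j) * X $ i $ k * N $ k $ j)"
    by (rule sum.cong[OF refl], rule sum.swap)
  also have "\<dots> = fdot (Y ** cadjoint N) X"
    by (simp add: fdot_def matrix_matrix_mult_def cadjoint_def sum_distrib_left sum_distrib_right mult_ac)
  finally show ?thesis .
qed

section \<open>Adjoints, transposes and simultaneous diagonalisation\<close>

lemma cadjoint_mult: "cadjoint (A ** B) = cadjoint B ** cadjoint A"
  by (simp add: vec_eq_iff cadjoint_def matrix_matrix_mult_def mult.commute)

lemma cadjoint_cadjoint [simp]: "cadjoint (cadjoint A) = A"
  by (simp add: vec_eq_iff cadjoint_def)

lemma cadjoint_rdiag [simp]: "cadjoint (rdiag d) = rdiag d"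
  by (simp add: vec_eq_iff cadjoint_def rdiag_def)

lemma transpose_rdiag [simp]: "transpose (rdiag d) = rdiag d"
  by (simp add: vec_eq_iff transpose_def rdiag_def)

lemma cadjoint_transpose: "cadjoint (transpose A) = transpose (cadjoint A)"
  by (simp add: vec_eq_iff cadjoint_def transpose_def)

lemma rdiag_one: "rdiag (\<lambda>_. 1) = mat 1"
  by (simp add: vec_eq_iff rdiag_def mat_def)

lemma hermitian_sandwich: "hermitian (U ** rdiag d ** cadjoint U)"
  by (simp add: hermitian_def cadjoint_mult matrix_mul_assoc)

text \<open>If u_k and v_l are the columns of \<open>U\<close> and \<open>V\<close>, entry (k, l) is
  the Frobenius coefficient of \<open>X\<close> along the rank-one matrix u_k v_l^T. These matrices
  are common eigenvectors of left multiplication by \<open>U ** rdiag f ** cadjoint U\<close> and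
  right multiplication by the transpose of \<open>V ** rdiag g ** cadjoint V\<close> when
  \<open>U\<close> and \<open>V\<close> are unitary.\<close>

definition sandwich_coords :: "complex^'n^'n \<Rightarrow> complex^'m^'m \<Rightarrow> complex^'m^'n \<Rightarrow> complex^'m^'n" where
  "sandwich_coords U V X = cadjoint U ** X ** cadjoint (transpose V)"

text \<open>The outer factors \<open>U\<close> and \<open>transpose V\<close> cross the pairing as
  adjoints and turn \<open>Y\<close> into its coordinates; the inner ones already form the
  coordinates of \<open>X\<close>. Only the two diagonal factors remain between them, acting on
  entry (k, l) by \<open>f k * g l\<close>.\<close>

lemma fdot_sandwich:
  "fdot Y (U ** rdiag f ** cadjoint U ** X ** transpose (V ** rdiag g ** cadjoint V))
   = (\<Sum>k\<in>UNIV. \<Sum>l\<in>UNIV. of_real (f k * g l) *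
        (cnj (sandwich_coords U V Y $ k $ l) * sandwich_coords U V X $ k $ l))"
proof -
  let ?T = "transpose V"
  have "U ** rdiag f ** cadjoint U ** X ** transpose (V ** rdiag g ** cadjoint V)
      = U ** ((rdiag f ** sandwich_coords U V X ** rdiag g) ** ?T)"
    by (simp add: sandwich_coords_def matrix_transpose_mul cadjoint_transpose matrix_mul_assoc)
  then have "fdot Y (U ** rdiag f ** cadjoint U ** X ** transpose (V ** rdiag g ** cadjoint V))
     = fdot (sandwich_coords U V Y) (rdiag f ** sandwich_coords U V X ** rdiag g)"
    by (simp only: fdot_mult_left[of _ U] fdot_mult_right[of _ _ ?T] sandwich_coords_def)
  then show ?thesis
    by (simp add: fdot_def rdiag_mult_right rdiag_mult_left mult_ac)
qed

text \<open>Lets a maximiser be prescribed coordinate by coordinate and then realised by an actual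
  matrix.\<close>

lemma sandwich_coords_surj:
  assumes "unitary U" "unitary V"
  shows "sandwich_coords U V (U ** W ** transpose V) = W"
proof -
  have "transpose V ** cadjoint (transpose V) = transpose (cadjoint V ** V)"
    by (simp add: matrix_transpose_mul cadjoint_transpose)
  also have "\<dots> = mat 1" using assms by (simp add: unitary_def transpose_mat)
  finally have T: "transpose V ** cadjoint (transpose V) = mat 1" .
  have "sandwich_coords U V (U ** W ** transpose V)
    = (cadjoint U ** U) ** W ** (transpose V ** cadjoint (transpose V))"
    by (simp add: sandwich_coords_def matrix_mul_assoc)
  then show ?thesis using assms T by (simp add: unitary_def)
qed

definition cdiag :: "complex^'n \<Rightarrow> complex^'n^'n" where
  "cdiag x = (\<chi> i j. if i = j then x $ i else 0)"

text \<open>The diagonal entry (i, i) of F diag(x) G^T is the sum over k of F_ik x_k G_ik, which is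
  entry i of the Hadamard product applied to x. The second factor must be transposed, not adjoined,
  because the Hadamard product does not conjugate.\<close>

lemma cdot_hadamard:
  "cdot x ((F \<odot> G) *v x) = fdot (cdiag x) (F ** cdiag x ** transpose G)"
proof -
  have 1: "(F ** cdiag x) $ i $ j = F $ i $ j * x $ j" for i j
    by (simp add: cdiag_def matrix_matrix_mult_def if_distrib cong: if_cong)
  have 2: "(F ** cdiag x ** transpose G) $ i $ i = (\<Sum>k\<in>UNIV. F $ i $ k * x $ k * G $ i $ k)" for i
    unfolding matrix_matrix_mult_def[of "F ** cdiag x"] by (simp add: 1 transpose_def)
  have "fdot (cdiag x) N = (\<Sum>i\<in>UNIV. cnj (x $ i) * N $ i $ i)" for N :: "complex^'a^'a"
    by (simp add: fdot_def cdiag_def if_distrib if_distribR cong: if_cong)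
  then show ?thesis
    by (simp add: 2) (simp add: cdot_def hadamard_def matrix_vector_mult_def mult_ac)
qed

subsection \<open>The resolvent form\<close>

text \<open>For fixed \<open>Y\<close> this is linear in \<open>(A, C)\<close>, and its supremum over \<open>Y\<close> is the quadratic form at
  \<open>X\<close> of \<open>L (L + t R)\<^sup>-\<^sup>1 L\<close>, where \<open>L\<close> is left multiplication by \<open>A\<close> and \<open>R\<close> is right
  multiplication by the transpose of \<open>C\<close>.\<close>

definition resolvent_test ::
  "real \<Rightarrow> complex^'n^'n \<Rightarrow> complex^'n^'n \<Rightarrow> complex^'n^'n \<Rightarrow> complex^'n^'n \<Rightarrow> real" where
  "resolvent_test t A C X Y =
     2 * Re (fdot Y (A ** X)) - Re (fdot Y (A ** Y)) - t * Re (fdot Y (Y ** transpose C))"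

text \<open>The quadratic form of L (L + t R)^(-1) L in eigencoordinates: L and R act on coordinate
  (k, l) by \<open>a k\<close> and \<open>c l\<close>. Writing it with spectral data avoids forming
  the inverse of an operator on matrices.\<close>

definition resolvent_form ::
  "real \<Rightarrow> complex^'n^'n \<Rightarrow> ('n \<Rightarrow> real) \<Rightarrow> complex^'n^'n \<Rightarrow> ('n \<Rightarrow> real) \<Rightarrow> complex^'n^'n \<Rightarrow> real" where
  "resolvent_form t U a V c X =
     (\<Sum>k\<in>UNIV. \<Sum>l\<in>UNIV. (a k)\<^sup>2 / (a k + t * c l) * (norm (sandwich_coords U V X $ k $ l))\<^sup>2)"

lemma matrix_add_scaleR_mult:
  fixes A B X :: "complex^'n^'n"
  shows "(\<alpha> *\<^sub>R A + \<beta> *\<^sub>R B) ** X = \<alpha> *\<^sub>R (A ** X) + \<beta> *\<^sub>R (B ** X)"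
  by (simp add: vec_eq_iff matrix_matrix_mult_def sum.distrib scaleR_sum_right distrib_right)

lemma matrix_mult_transpose_add_scaleR:
  fixes C D Y :: "complex^'n^'n"
  shows "Y ** transpose (\<alpha> *\<^sub>R C + \<beta> *\<^sub>R D) = \<alpha> *\<^sub>R (Y ** transpose C) + \<beta> *\<^sub>R (Y ** transpose D)"
  by (simp add: vec_eq_iff matrix_matrix_mult_def transpose_def sum.distrib scaleR_sum_right distrib_left)

lemma resolvent_test_linear:
  "resolvent_test t (\<alpha> *\<^sub>R A + \<beta> *\<^sub>R B) (\<alpha> *\<^sub>R C + \<beta> *\<^sub>R D) X Y
     = \<alpha> * resolvent_test t A C X Y + \<beta> * resolvent_test t B D X Y"
  by (simp add: resolvent_test_def matrix_add_scaleR_mult matrix_mult_transpose_add_scaleR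
      fdot_add_right fdot_scaleR_right algebra_simps)

lemma resolvent_test_spectral:
  fixes A C X Y :: "complex^'n^'n"
  assumes A: "spectral_decomp A U a" and C: "spectral_decomp C V c"
  defines "Z \<equiv> sandwich_coords U V X" and "W \<equiv> sandwich_coords U V Y"
  shows "resolvent_test t A C X Y = (\<Sum>k\<in>UNIV. \<Sum>l\<in>UNIV.
    2 * a k * Re (cnj (W $ k $ l) * Z $ k $ l) - (a k + t * c l) * (norm (W $ k $ l))\<^sup>2)"
proof -
  have u: "unitary U" "unitary V" and AU: "A = U ** rdiag a ** cadjoint U"
    and CV: "C = V ** rdiag c ** cadjoint V"
    using A C by (auto simp: spectral_decomp_def)
  \<comment> \<open>Each term of the test involves only one of the two multiplications. The other is
    written as a sandwich with constant eigenvalue 1, so that \<open>fdot_sandwich\<close>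
    applies.\<close>
  have one: "U ** rdiag (\<lambda>_. 1) ** cadjoint U = mat 1" "V ** rdiag (\<lambda>_. 1) ** cadjoint V = mat 1"
    using u by (simp_all add: rdiag_one unitary_def)
  have n: "Re (cnj z * z) = (norm z)\<^sup>2" for z
    unfolding cmod_power2 by (simp add: power2_eq_square)
  have re: "Re (of_real s * z) = s * Re z" for s z by simp
  have 1: "fdot Y (A ** M) = (\<Sum>k\<in>UNIV. \<Sum>l\<in>UNIV. of_real (a k) *
        (cnj (W $ k $ l) * sandwich_coords U V M $ k $ l))" for M
    using fdot_sandwich[of Y U a M V "\<lambda>_. 1"] by (simp add: one AU W_def transpose_mat)
  have 2: "fdot Y (Y ** transpose C) = (\<Sum>k\<in>UNIV. \<Sum>l\<in>UNIV. of_real (c l) *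
        (cnj (W $ k $ l) * W $ k $ l))"
    using fdot_sandwich[of Y U "\<lambda>_. 1" Y V c] by (simp add: one CV W_def)
  show ?thesis
    unfolding resolvent_test_def 1 2 W_def[symmetric] Z_def[symmetric]
    by (simp only: Re_sum re n sum_distrib_left)
      (simp add: sum_subtractf sum.distrib algebra_simps)
qed

lemma complete_square:
  fixes p q :: real and w z :: complex
  assumes "q > 0"
  shows "2 * p * Re (cnj w * z) - q * (norm w)\<^sup>2 \<le> p\<^sup>2 / q * (norm z)\<^sup>2"
proof -
  have "0 \<le> (norm (of_real q * w - of_real p * z))\<^sup>2 / q" using assms by simp
  also have "\<dots> = q * (norm w)\<^sup>2 - 2 * p * Re (cnj w * z) + p\<^sup>2 / q * (norm z)\<^sup>2"
    using assms unfolding cmod_power2 by (simp add: field_simps power2_eq_square)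
  finally show ?thesis by simp
qed

text \<open>The chosen \<open>w\<close> is the zero of the square q w - p z dropped in
  \<open>complete_square\<close>.\<close>

lemma complete_square_eq:
  fixes p q :: real and z :: complex
  assumes "q > 0" and w: "w = of_real (p / q) * z"
  shows "2 * p * Re (cnj w * z) - q * (norm w)\<^sup>2 = p\<^sup>2 / q * (norm z)\<^sup>2"
  using assms(1) unfolding w cmod_power2 by (simp add: field_simps power2_eq_square)

lemma resolvent_test_le:
  assumes "spectral_decomp A U a" "spectral_decomp C V c"
    and "\<And>k. a k > 0" "\<And>l. c l > 0" "t > 0"
  shows "resolvent_test t A C X Y \<le> resolvent_form t U a V c X"
  unfolding resolvent_test_spectral[OF assms(1,2)] resolvent_form_def
  by (intro sum_mono complete_square) (simp add: assms add_pos_pos)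

lemma resolvent_test_attained:
  fixes A C X :: "complex^'n^'n"
  assumes "spectral_decomp A U a" "spectral_decomp C V c"
    and "\<And>k. a k > 0" "\<And>l. c l > 0" "t > 0"
  shows "\<exists>Y. resolvent_test t A C X Y = resolvent_form t U a V c X"
proof -
  \<comment> \<open>The entrywise maximiser, with p = \<open>a k\<close> and q =
    \<open>a k + t * c l\<close>: these are the coordinates of Y = (L + t R)^(-1) L X.\<close>
  define W :: "complex^'n^'n" where
    "W = (\<chi> k l. of_real (a k / (a k + t * c l)) * sandwich_coords U V X $ k $ l)"
  have "sandwich_coords U V (U ** W ** transpose V) = W"
    using assms by (intro sandwich_coords_surj) (auto simp: spectral_decomp_def)
  then show ?thesis
    unfolding resolvent_test_spectral[OF assms(1,2)] resolvent_form_def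
    by (intro exI[of _ "U ** W ** transpose V"] sum.cong refl complete_square_eq)
      (simp_all add: assms add_pos_pos W_def)
qed


subsection \<open>The integral representation\<close>

lemma powr_pred_mult:
  fixes x a :: real
  shows "x > 0 \<Longrightarrow> x powr (a - 1) * x = x powr a"
  by (simp add: powr_diff)

lemma integrable_resolvent_kernel:
  fixes r :: real
  assumes "1 < r" "r < 2"
  shows "integrable lborel (\<lambda>t. indicator {0<..} t * (t powr (r - 2) / (1 + t)))"
\<comment> \<open>The kernel is dominated by t^(r-2) near 0, integrable since r > 1, and by t^(r-3)
  near infinity, integrable since r < 2. Both majorants are nonnegative, so their sum is still a
  bound at the shared point 1.\<close>
proof (rule Bochner_Integration.integrable_bound[OF _ _ AE_I2])
  have "(\<lambda>t::real. t powr (r - 2)) absolutely_integrable_on {0<..1}"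
    using assms by (intro nonnegative_absolutely_integrable_1 integrable_on_powr_from_0') auto
  then have 1: "integrable lborel (\<lambda>t. indicator {0<..1} t * t powr (r - 2))"
    unfolding set_integrable_def by (subst (asm) integrable_completion) auto
  have "(\<lambda>t::real. t powr (r - 3)) absolutely_integrable_on {1..}"
    using assms has_integral_powr_to_inf[of "r - 3" 1]
    by (intro nonnegative_absolutely_integrable_1) (auto simp: integrable_on_def)
  then have 2: "integrable lborel (\<lambda>t. indicator {1..} t * t powr (r - 3))"
    unfolding set_integrable_def by (subst (asm) integrable_completion) auto
  show "integrable lborel
      (\<lambda>t. indicator {0<..1} t * t powr (r - 2) + indicator {1..} t * t powr (r - 3))"
    using 1 2 by (rule Bochner_Integration.integrable_add)
  show "(\<lambda>t. indicator {0<..} t * (t powr (r - 2) / (1 + t))) \<in> borel_measurable lborel"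
    by measurable
  fix t :: real
  have "t powr (r - 2) / (1 + t) \<le> t powr (r - 2)" if "t > 0"
    using that by (simp add: divide_le_eq mult_left_le mult_le_cancel_left1 algebra_simps)
  moreover have "t powr (r - 2) / (1 + t) \<le> t powr (r - 3)" if "t > 0"
  proof -
    have "t powr (r - 2) = t powr (r - 3) * t" using powr_pred_mult[of t "r - 2"] that by simp
    then show ?thesis using that by (simp add: divide_le_eq algebra_simps)
  qed
  ultimately show "norm (indicator {0<..} t * (t powr (r - 2) / (1 + t)))
      \<le> norm (indicator {0<..1} t * t powr (r - 2) + indicator {1..} t * t powr (r - 3))"
    by (auto simp: indicator_def)
qed

text \<open>The constant K of the integral identity, read off at p = q = 1. For 1 < r < 2 it is a
  Beta integral with value pi / sin (pi (r - 1)). Its positivity allows it to be cancelled after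
  integration.\<close>

definition resolvent_const :: "real \<Rightarrow> real" where
  "resolvent_const r = (LBINT t. indicator {0<..} t * (t powr (r - 2) / (1 + t)))"

lemma resolvent_const_pos:
  assumes "1 < r" "r < 2"
  shows "resolvent_const r > 0"
proof -
  \<comment> \<open>On [1, 2] the numerator t^(r-2) is at least 1/t, hence at least 1/2, and the
    denominator 1 + t is at most 3.\<close>
  have "1 / 6 = (LBINT t::real. indicator {1..2} t * (1 / 6 :: real))" by simp
  also have "\<dots> \<le> resolvent_const r"
    unfolding resolvent_const_def
  proof (rule integral_mono[OF _ integrable_resolvent_kernel[OF assms]])
    show "integrable lborel (\<lambda>t::real. indicator {1..2} t * (1 / 6 :: real))" by simp
    fix t :: real
    have "1 / 6 \<le> t powr (r - 2) / (1 + t)" if t: "1 \<le> t" "t \<le> 2"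
    proof -
      have "1 / 2 \<le> t powr (- 1)" using t by (simp add: powr_minus field_simps)
      also have "\<dots> \<le> t powr (r - 2)" using t assms by (intro powr_mono) auto
      finally have "1 / 2 / 3 \<le> t powr (r - 2) / (1 + t)" using t by (intro frac_le) auto
      then show ?thesis by simp
    qed
    then show "indicator {1..2} t * (1 / 6) \<le> indicator {0<..} t * (t powr (r - 2) / (1 + t))"
      by (auto simp: indicator_def)
  qed
  finally show ?thesis by simp
qed

text \<open>By homogeneity the identity reduces to p = q = 1: the substitution of (q/p) t for t in
  the integral defining \<open>resolvent_const\<close> produces the denominator p + t q.\<close>

lemma has_integral_resolvent:
  fixes p q r :: real
  assumes r: "1 < r" "r < 2" and pos: "p > 0" "q > 0"
  shows "has_bochner_integral lborel
    (\<lambda>t. indicator {0<..} t * t powr (r - 2) * (p\<^sup>2 / (p + t * q)))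
    (resolvent_const r * (p powr r * q powr (1 - r)))"
proof -
  let ?h = "\<lambda>t::real. indicator {0<..} t * (t powr (r - 2) / (1 + t))"
  have "has_bochner_integral lborel ?h (resolvent_const r)"
    unfolding resolvent_const_def
    by (rule has_bochner_integral_integrable[OF integrable_resolvent_kernel[OF r]])
  then have "has_bochner_integral lborel (\<lambda>t. ?h (0 + (q / p) * t)) (resolvent_const r /\<^sub>R \<bar>q / p\<bar>)"
    using pos by (subst lborel_has_bochner_integral_real_affine_iff[symmetric]) auto
  \<comment> \<open>The substituted kernel equals (q/p)^(r-2) p t^(r-2) / (p + t q). The factor
    p^(r-1) q^(2-r) removes the power of q and raises the numerator to p^2.\<close>
  then have "has_bochner_integral lborel (\<lambda>t. p powr (r - 1) * q powr (2 - r) * ?h (0 + (q / p) * t))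
     (p powr (r - 1) * q powr (2 - r) * (resolvent_const r /\<^sub>R \<bar>q / p\<bar>))"
    by (rule has_bochner_integral_mult_right)
  moreover have "p powr (r - 1) * q powr (2 - r) * ?h (0 + (q / p) * t)
      = indicator {0<..} t * t powr (r - 2) * (p\<^sup>2 / (p + t * q))" for t
  proof (cases "t > 0")
    case True
    have 1: "(q / p * t) powr (r - 2) = q powr (r - 2) / p powr (r - 2) * t powr (r - 2)"
      using pos True by (simp add: powr_mult powr_divide)
    have 2: "q powr (2 - r) * q powr (r - 2) = 1"
      using pos by (simp flip: powr_add)
    have 3: "p powr (r - 1) / p powr (r - 2) = p"
      using powr_pred_mult[of p "r - 1"] pos by (simp add: field_simps)
    have "p powr (r - 1) * q powr (2 - r) * (q / p * t) powr (r - 2)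
        = (q powr (2 - r) * q powr (r - 2)) * (p powr (r - 1) / p powr (r - 2)) * t powr (r - 2)"
      unfolding 1 by (simp add: mult_ac)
    also have "\<dots> = p * t powr (r - 2)" by (simp only: 2 3 mult_1)
    finally have "p powr (r - 1) * q powr (2 - r) * (q / p * t) powr (r - 2) = p * t powr (r - 2)" .
    moreover have "1 + q / p * t = (p + t * q) / p"
      using pos by (simp add: field_simps)
    ultimately show ?thesis
      using True pos by (simp add: indicator_def power2_eq_square mult_ac)
  \<comment> \<open>For t \<le> 0 also (q/p) t \<le> 0, so both indicators vanish.\<close>
  qed (use pos in \<open>auto simp: indicator_def zero_less_mult_iff zero_less_divide_iff\<close>)
  moreover have "p powr (r - 1) * q powr (2 - r) * (resolvent_const r /\<^sub>R \<bar>q / p\<bar>)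
      = resolvent_const r * (p powr r * q powr (1 - r))"
  proof -
    have 1: "p powr (r - 1) * p = p powr r" "q powr (1 - r) * q = q powr (2 - r)"
      using powr_pred_mult[of p r] powr_pred_mult[of q "2 - r"] pos by simp_all
    show ?thesis unfolding 1[symmetric] using pos by (simp add: field_simps)
  qed
  ultimately show ?thesis by (simp only:)
qed

text \<open>Both arguments of the pairing are \<open>cdiag x\<close>, so each coordinate enters
  through its squared modulus. The form is thus a combination, with nonnegative weights, of the
  scalars to which the integral identity applies.\<close>

lemma cdot_hadamard_mpow:
  assumes "spectral_decomp A U a" "spectral_decomp C V c"
  shows "Re (cdot x ((A mpow r \<odot> C mpow r') *v x)) =
    (\<Sum>k\<in>UNIV. \<Sum>l\<in>UNIV. a k powr r * c l powr r' *
       (norm (sandwich_coords U V (cdiag x) $ k $ l))\<^sup>2)"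
proof -
  have n: "cnj z * z = of_real ((norm z)\<^sup>2)" for z
    by (subst complex_norm_square) (rule mult.commute)
  show ?thesis
    unfolding cdot_hadamard mpow_def fun_calc_eq[OF assms(1)] fun_calc_eq[OF assms(2)] fdot_sandwich n
    by simp
qed

text \<open>The scalar identity with p = \<open>a k\<close> and q = \<open>c l\<close>, summed over
  k and l with the squared moduli of the coordinates of \<open>cdiag x\<close> as weights.\<close>

lemma has_integral_resolvent_form:
  assumes "spectral_decomp A U a" "spectral_decomp C V c"
    and "\<And>k. a k > 0" "\<And>l. c l > 0" "1 < r" "r < 2"
  shows "has_bochner_integral lborel
    (\<lambda>t. indicator {0<..} t * t powr (r - 2) * resolvent_form t U a V c (cdiag x))
    (resolvent_const r * Re (cdot x ((A mpow r \<odot> C mpow (1 - r)) *v x)))"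
  unfolding cdot_hadamard_mpow[OF assms(1,2)] resolvent_form_def sum_distrib_left mult.assoc[symmetric]
  by (intro has_bochner_integral_sum has_bochner_integral_mult_left)
    (use has_integral_resolvent[OF assms(5,6)] assms(3,4) in \<open>simp add: mult.assoc\<close>)

subsection \<open>Joint convexity\<close>

lemma hermitian_fun_calc:
  assumes "hermitian A"
  shows "hermitian (fun_calc f A)"
  using hermitian_spectral_decomp[OF assms] by (auto simp: fun_calc_eq hermitian_sandwich)

lemma hermitian_add_scaleR:
  fixes A B :: "complex^'n^'n"
  assumes "hermitian A" "hermitian B"
  shows "hermitian (\<alpha> *\<^sub>R A + \<beta> *\<^sub>R B)"
  using assms by (simp add: hermitian_def cadjoint_def vec_eq_iff)

lemma hermitian_hadamard:
  assumes "hermitian A" "hermitian B"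
  shows "hermitian (A \<odot> B)"
  using assms by (simp add: hermitian_def cadjoint_def vec_eq_iff hadamard_def)

lemma pos_def_hermitian: "pos_def A \<Longrightarrow> hermitian A"
  by (simp add: pos_def_def psd_def)

lemma cdot_rdiag:
  "cdot y (rdiag d *v y) = (\<Sum>k\<in>UNIV. of_real (d k * (norm (y $ k))\<^sup>2))"
proof -
  have 1: "(rdiag d *v y) $ k = of_real (d k) * y $ k" for k
    by (simp add: rdiag_def matrix_vector_mult_def if_distrib if_distribR cong: if_cong)
  have 2: "cnj z * (of_real s * z) = of_real (s * (norm z)\<^sup>2)" for z s
    unfolding of_real_mult complex_norm_square by simp
  show ?thesis unfolding cdot_def 1 2 ..
qed

text \<open>In the coordinates y = U^* x the form is the sum of d_k |y_k|^2. All eigenvalues d_k are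
  positive, and some y_k is nonzero because U y = x.\<close>

lemma pos_def_cdot_pos:
  assumes A: "pos_def A" and x: "x \<noteq> 0"
  shows "Re (cdot x (A *v x)) > 0"
proof -
  obtain U d where D: "spectral_decomp A U d"
    using hermitian_spectral_decomp[OF pos_def_hermitian[OF A]] by blast
  have U: "U ** cadjoint U = mat 1" and AU: "A = U ** rdiag d ** cadjoint U"
    using D by (auto simp: spectral_decomp_def unitary_def)
  let ?y = "cadjoint U *v x"
  have adj: "cdot x (U *v z) = cdot ?y z" for z
    unfolding cdot_def cadjoint_def matrix_vector_mult_def
    by (simp add: sum_distrib_left sum_distrib_right mult_ac) (rule sum.swap)
  have "A *v x = U *v (rdiag d *v ?y)"
    by (simp add: AU matrix_vector_mul_assoc matrix_mul_assoc)
  then have "cdot x (A *v x) = cdot ?y (rdiag d *v ?y)" by (simp add: adj)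
  also have "\<dots> = (\<Sum>k\<in>UNIV. of_real (d k * (norm (?y $ k))\<^sup>2))"
    by (rule cdot_rdiag)
  finally have eq: "Re (cdot x (A *v x)) = (\<Sum>k\<in>UNIV. d k * (norm (?y $ k))\<^sup>2)" by simp
  have "U *v ?y = x" using U by (simp add: matrix_vector_mul_assoc)
  then have "?y \<noteq> 0" using x by auto
  then obtain k where "?y $ k \<noteq> 0" by (auto simp: vec_eq_iff)
  then show ?thesis
    unfolding eq using pos_def_eigenvalues_pos[OF A D]
    by (intro sum_pos2[of _ k]) (auto simp: less_imp_le)
qed

lemma cdot_hermitian_real:
  assumes "hermitian A"
  shows "cdot x (A *v x) = of_real (Re (cdot x (A *v x)))"
  using hermitian_cdot[OF assms, of x x] cdot_cnj[of x "A *v x"] by (simp add: complex_eq_iff)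

text \<open>In the order on complex numbers, being nonnegative includes being real; the quadratic
  form of a Hermitian matrix is real, so only its real part has to be checked.\<close>

lemma psdI:
  assumes "hermitian A" "\<And>x. 0 \<le> Re (cdot x (A *v x))"
  shows "psd A"
  unfolding psd_def
proof (intro conjI allI)
  fix x
  show "0 \<le> cdot x (A *v x)"
    by (subst cdot_hermitian_real[OF assms(1)]) (simp add: assms(2) less_eq_complex_def)
qed (fact assms(1))

lemma cdot_add_scaleR:
  fixes A B :: "complex^'n^'n"
  shows "cdot x ((\<alpha> *\<^sub>R A + \<beta> *\<^sub>R B) *v y) = of_real \<alpha> * cdot x (A *v y) + of_real \<beta> * cdot x (B *v y)"
proof -
  have "(\<alpha> *\<^sub>R A + \<beta> *\<^sub>R B) *v y = \<alpha> *\<^sub>R (A *v y) + \<beta> *\<^sub>R (B *v y)"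
    by (simp add: vec_eq_iff matrix_vector_mult_def sum.distrib scaleR_sum_right distrib_right)
  then show ?thesis by (simp add: cdot_add cdot_scaleR)
qed

lemma pos_def_add_scaleR:
  fixes A B :: "complex^'n^'n"
  assumes A: "pos_def A" and B: "pos_def B" and ab: "\<alpha> > 0" "\<beta> > 0"
  shows "pos_def (\<alpha> *\<^sub>R A + \<beta> *\<^sub>R B)"
proof -
  let ?M = "\<alpha> *\<^sub>R A + \<beta> *\<^sub>R B"
  have h: "hermitian ?M"
    using A B by (simp add: hermitian_add_scaleR pos_def_hermitian)
  have pos: "Re (cdot x (?M *v x)) > 0" if "x \<noteq> 0" for x
    unfolding cdot_add_scaleR using that ab pos_def_cdot_pos[OF A that] pos_def_cdot_pos[OF B that]
    by (simp add: add_pos_pos)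
  then have "Re (cdot x (?M *v x)) \<ge> 0" for x
    by (cases "x = 0") (auto simp: less_imp_le cdot_def)
  then have "psd ?M"
    using h by (simp add: psdI)
  \<comment> \<open>A kernel vector makes the quadratic form vanish, so strict positivity forces it
    to be 0; a square matrix with trivial kernel is invertible.\<close>
  moreover have "x = 0" if "?M *v x = 0" for x
    using pos[of x] that by (auto simp: cdot_def)
  then have "invertible ?M"
    by (metis invertible_left_inverse matrix_left_invertible_ker)
  ultimately show ?thesis by (simp add: pos_def_def)
qed

text \<open>A supremum of linear functions of the pair of matrices is sublinear: the maximiser
  \<open>Y\<close> for the combined pair is only a candidate for each of the two original pairs. The
  weights therefore need not sum to 1.\<close>

lemma resolvent_form_convex:
  assumes "spectral_decomp A U a" "spectral_decomp C V c" "\<And>k. a k > 0" "\<And>l. c l > 0"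
    and "spectral_decomp B U' b" "spectral_decomp D V' d" "\<And>k. b k > 0" "\<And>l. d l > 0"
    and "spectral_decomp (\<alpha> *\<^sub>R A + \<beta> *\<^sub>R B) U'' e" "spectral_decomp (\<alpha> *\<^sub>R C + \<beta> *\<^sub>R D) V'' f"
    and "\<And>k. e k > 0" "\<And>l. f l > 0" "\<alpha> > 0" "\<beta> > 0" "t > 0"
  shows "resolvent_form t U'' e V'' f X
    \<le> \<alpha> * resolvent_form t U a V c X + \<beta> * resolvent_form t U' b V' d X"
proof -
  obtain Y where "resolvent_form t U'' e V'' f X
      = resolvent_test t (\<alpha> *\<^sub>R A + \<beta> *\<^sub>R B) (\<alpha> *\<^sub>R C + \<beta> *\<^sub>R D) X Y"
    using resolvent_test_attained[OF assms(9,10,11,12,15), of X] by metis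
  also have "\<dots> = \<alpha> * resolvent_test t A C X Y + \<beta> * resolvent_test t B D X Y"
    by (rule resolvent_test_linear)
  also have "\<dots> \<le> \<alpha> * resolvent_form t U a V c X + \<beta> * resolvent_form t U' b V' d X"
    using resolvent_test_le[OF assms(1-4) assms(15)] resolvent_test_le[OF assms(5-8) assms(15)] assms(13,14)
    by (intro add_mono mult_left_mono) auto
  finally show ?thesis .
qed

text \<open>The resolvent inequality is multiplied by the nonnegative weight t^(r-2), integrated
  over t > 0, and divided by K > 0.\<close>

lemma cdot_hadamard_mpow_convex:
  fixes A B C D :: "complex^'n^'n"
  assumes A: "pos_def A" and B: "pos_def B" and C: "pos_def C" and D: "pos_def D"
    and ab: "\<alpha> > 0" "\<beta> > 0" and r: "1 < r" "r < 2"
  shows "Re (cdot x (((\<alpha> *\<^sub>R A + \<beta> *\<^sub>R B) mpow r \<odot> (\<alpha> *\<^sub>R C + \<beta> *\<^sub>R D) mpow (1 - r)) *v x))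
    \<le> \<alpha> * Re (cdot x ((A mpow r \<odot> C mpow (1 - r)) *v x))
      + \<beta> * Re (cdot x ((B mpow r \<odot> D mpow (1 - r)) *v x))"
    (is "?l \<le> \<alpha> * ?p + \<beta> * ?q")
proof -
  have ex: "\<exists>U d. spectral_decomp M U d \<and> (\<forall>k. d k > 0)" if "pos_def M" for M :: "complex^'n^'n"
    using hermitian_spectral_decomp[OF pos_def_hermitian[OF that]] pos_def_eigenvalues_pos[OF that]
    by blast
  obtain U a where a: "spectral_decomp A U a" "\<And>k. a k > 0" using ex[OF A] by blast
  obtain U' b where b: "spectral_decomp B U' b" "\<And>k. b k > 0" using ex[OF B] by blast
  obtain V c where c: "spectral_decomp C V c" "\<And>k. c k > 0" using ex[OF C] by blast
  obtain V' d where d: "spectral_decomp D V' d" "\<And>k. d k > 0" using ex[OF D] by blast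
  obtain U'' e where e: "spectral_decomp (\<alpha> *\<^sub>R A + \<beta> *\<^sub>R B) U'' e" "\<And>k. e k > 0"
    using ex[OF pos_def_add_scaleR[OF A B ab]] by blast
  obtain V'' f where f: "spectral_decomp (\<alpha> *\<^sub>R C + \<beta> *\<^sub>R D) V'' f" "\<And>k. f k > 0"
    using ex[OF pos_def_add_scaleR[OF C D ab]] by blast
  let ?w = "\<lambda>t::real. indicator {0<..} t * t powr (r - 2)"
  let ?K = "resolvent_const r"
  have L: "has_bochner_integral lborel (\<lambda>t. ?w t * resolvent_form t U'' e V'' f (cdiag x)) (?K * ?l)"
    by (rule has_integral_resolvent_form[OF e(1) f(1) e(2) f(2) r])
  have R: "has_bochner_integral lborel
      (\<lambda>t. \<alpha> * (?w t * resolvent_form t U a V c (cdiag x))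
         + \<beta> * (?w t * resolvent_form t U' b V' d (cdiag x))) (\<alpha> * (?K * ?p) + \<beta> * (?K * ?q))"
    by (intro has_bochner_integral_add has_bochner_integral_mult_right
        has_integral_resolvent_form a b c d r)
  have "?w t * resolvent_form t U'' e V'' f (cdiag x)
     \<le> \<alpha> * (?w t * resolvent_form t U a V c (cdiag x))
       + \<beta> * (?w t * resolvent_form t U' b V' d (cdiag x))" for t
  proof (cases "t > 0")
    case True
    then show ?thesis
      using mult_left_mono[OF resolvent_form_convex[OF a(1) c(1) a(2) c(2) b(1) d(1) b(2) d(2)
          e(1) f(1) e(2) f(2) ab True, of "cdiag x"], of "t powr (r - 2)"]
      by (simp add: algebra_simps)
  qed simp
  then have "integral\<^sup>L lborel (\<lambda>t. ?w t * resolvent_form t U'' e V'' f (cdiag x))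
    \<le> integral\<^sup>L lborel (\<lambda>t. \<alpha> * (?w t * resolvent_form t U a V c (cdiag x))
         + \<beta> * (?w t * resolvent_form t U' b V' d (cdiag x)))"
    by (intro integral_mono has_bochner_integral_iff[THEN iffD1, OF L, THEN conjunct1]
        has_bochner_integral_iff[THEN iffD1, OF R, THEN conjunct1])
  then have "?K * ?l \<le> ?K * (\<alpha> * ?p + \<beta> * ?q)"
    using L R by (simp add: has_bochner_integral_iff algebra_simps)
  then show ?thesis using resolvent_const_pos[OF r] by simp
qed

lemma hadamard_commute: "A \<odot> B = B \<odot> A"
  by (simp add: vec_eq_iff hadamard_def mult.commute)

theorem theorem2p6:
  fixes A B C D :: "complex^'n^'n" and \<alpha> \<beta> r :: real
  assumes "pos_def A" and "pos_def B" and "pos_def C" and "pos_def D"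
    and "\<alpha> > 0" and "\<beta> > 0"
    and "r \<in> {-1<..<0} \<union> {1<..<2}"
  shows "((\<alpha> *\<^sub>R A + \<beta> *\<^sub>R B) mpow r) \<odot> ((\<alpha> *\<^sub>R C + \<beta> *\<^sub>R D) mpow (1 - r))
    \<le>\<^sub>L \<alpha> *\<^sub>R ((A mpow r) \<odot> (C mpow (1 - r))) + \<beta> *\<^sub>R ((B mpow r) \<odot> (D mpow (1 - r)))"
    (is "?L \<le>\<^sub>L \<alpha> *\<^sub>R ?P + \<beta> *\<^sub>R ?Q")
proof -
  have "Re (cdot x (?L *v x)) \<le> \<alpha> * Re (cdot x (?P *v x)) + \<beta> * Re (cdot x (?Q *v x))" for x
  proof (cases "r > 1")
    case True
    then show ?thesis using cdot_hadamard_mpow_convex[of A B C D \<alpha> \<beta> r x] assms by auto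
  next
    \<comment> \<open>Now -1 < r < 0, so 1 - r lies in (1, 2) and 1 - (1 - r) = r. The convexity
      result applies with the pairs (A, B) and (C, D) exchanged, and commutativity of the Hadamard
      product restores the order.\<close>
    case False
    then show ?thesis
      using cdot_hadamard_mpow_convex[of C D A B \<alpha> \<beta> "1 - r" x] assms
      by (auto simp: hadamard_commute)
  qed
  moreover have hL: "hermitian ?L" and hR: "hermitian (\<alpha> *\<^sub>R ?P + \<beta> *\<^sub>R ?Q)"
    unfolding mpow_def using assms(1-4)
    by (simp_all add: hermitian_hadamard hermitian_add_scaleR hermitian_fun_calc pos_def_hermitian)
  ultimately have "0 \<le> Re (cdot x ((\<alpha> *\<^sub>R ?P + \<beta> *\<^sub>R ?Q - ?L) *v x))" for x
    by (simp add: matrix_vector_mult_diff_rdistrib cdot_diff cdot_add_scaleR)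
  moreover have hD: "hermitian (\<alpha> *\<^sub>R ?P + \<beta> *\<^sub>R ?Q - ?L)"
    using hermitian_add_scaleR[OF hR hL, of 1 "-1"] by simp
  ultimately have "psd (\<alpha> *\<^sub>R ?P + \<beta> *\<^sub>R ?Q - ?L)"
    by (simp add: psdI)
  then show ?thesis using hL hR by (simp add: loewner_le_def)
qed

end
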